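(* Let $\alpha = \{k_1, \ldots, k_p\}$ be any partition of $n$ with $p\ge 2$ blocks. The dual cone of $\mathcal{FW}_{\alpha,2}^n$ with respect to the trace inner product is $$ (\mathcal{FW}_{\alpha,2}^n)^* = \{X \in \mathbb{S}^n \mid E^{\alpha}_{ij} X (E^{\alpha}_{ij})^{\mathsf T} \succeq 0,\ 1\leq i < j \leq p\}. $$ Furthermore, both $\mathcal{FW}_{\alpha,2}^n$ and $(\mathcal{FW}_{\alpha,2}^n)^*$ are proper cones, i.e., they are convex, closed, solid (nonempty interior in $\mathbb{S}^n$), and pointed cones.
   Context: $\mathbb{S}^n$ denotes the real symmetric $n\times n$ matrices and $\mathbb{S}^n_+$ the positive semidefinite (PSD) ones; $X\succeq 0$ means $X$ is PSD. A partition of $n$ is an ordered list $\alpha=\{k_1,\ldots,k_p\}$ of positive integers with $\sum_{i=1}^p k_i=n$; throughout $p\ge 2$. Let $E_i^\alpha\in\mathbb{R}^{k_i\times n}$ be the $i$-th block row of $I_n$ when the rows of $I_n$ are split consecutively into blocks of sizes $k_1,\ldots,k_p$, and for $i\neq j$ let $E_{ij}^\alpha=\begin{bmatrix}(E_i^\alpha)^{\mathsf T} & (E_j^\alpha)^{\mathsf T}\end{bmatrix}^{\mathsf T}\in\mathbb{R}^{(k_i+k_j)\times n}$. The set $\mathcal{FW}_{\alpha,2}^n$ of block factor-width-two matrices consists of all $Z\in\mathbb{S}^n$ of the form $Z=\sum_{i=1}^{p-1}\sum_{j=i+1}^p (E^{\alpha}_{ij})^{\mathsf T} X_{ij} E^{\alpha}_{ij}$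 for some $X_{ij}\in\mathbb{S}^{k_i+k_j}_+$. The dual of a cone $K\subseteq\mathbb{S}^n$ is $K^*=\{X\in\mathbb{S}^n\mid \mathrm{tr}(XZ)\ge 0\ \forall Z\in K\}$. *)

theory Defs
  imports
    "HOL-Analysis.Abstract_Metric_Spaces"
    "HOL-Analysis.L2_Norm"
    "Jordan_Normal_Form.Matrix"
begin

definition mat_trace :: "'a::comm_monoid_add mat \<Rightarrow> 'a" where
  "mat_trace A = (\<Sum>i<dim_row A. A $$ (i, i))"

definition sym_mats :: "nat \<Rightarrow> real mat set" where
  "sym_mats n = {X \<in> carrier_mat n n. transpose_mat X = X}"

definition psd_mats :: "nat \<Rightarrow> real mat set" where
  "psd_mats n = {X \<in> sym_mats n. \<forall>v\<in>carrier_vec n. scalar_prod v (X *\<^sub>v v) \<ge> 0}"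

definition is_partition :: "nat list \<Rightarrow> nat \<Rightarrow> bool" where
  "is_partition ks n \<longleftrightarrow> (\<forall>k\<in>set ks. 0 < k) \<and> sum_list ks = n"

text \<open>Blocks are numbered from 0, so block \<open>i\<close> of the partition \<open>ks\<close> consists of the
  \<open>ks ! i\<close> consecutive rows of the identity matrix starting at row \<open>sum_list (take i ks)\<close>.\<close>

definition block_row :: "nat list \<Rightarrow> nat \<Rightarrow> nat \<Rightarrow> real mat" where
  "block_row ks n i =
     mat (ks ! i) n (\<lambda>(r, c). 1\<^sub>m n $$ (sum_list (take i ks) + r, c))"

definition block_row2 :: "nat list \<Rightarrow> nat \<Rightarrow> nat \<Rightarrow> nat \<Rightarrow> real mat" where
  "block_row2 ks n i j = append_rows (block_row ks n i) (block_row ks n j)"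

text \<open>The type \<open>real mat\<close> has no global zero matrix, so the sum is taken in the additive
  group of the module of \<open>n \<times> n\<close> matrices.\<close>

definition FW2 :: "nat list \<Rightarrow> nat \<Rightarrow> real mat set" where
  "FW2 ks n = {Z \<in> sym_mats n. \<exists>X.
     (\<forall>i j. i < j \<and> j < length ks \<longrightarrow> X i j \<in> psd_mats (ks ! i + ks ! j)) \<and>
     Z = finsum (module_mat TYPE(real) n n)
           (\<lambda>i. finsum (module_mat TYPE(real) n n)
             (\<lambda>j. transpose_mat (block_row2 ks n i j) * X i j * block_row2 ks n i j)
             {i+1..<length ks})
           {0..<length ks - 1}}"

definition dual_cone :: "nat \<Rightarrow> real mat set \<Rightarrow> real mat set" where
  "dual_cone n K = {X \<in> sym_mats n. \<forall>Z\<in>K. mat_trace (X * Z) \<ge> 0}"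

text \<open>The distance is summed over the index range, rather than written as a trace, so that it
  is a metric in the sense of \<open>Metric_space\<close>, whose axioms of nonnegativity and symmetry are
  not relativised to the carrier. On symmetric matrices it is the distance induced by the trace
  inner product, see \<open>frob_dist_eq_trace\<close>.\<close>

definition frob_dist :: "nat \<Rightarrow> real mat \<Rightarrow> real mat \<Rightarrow> real" where
  "frob_dist n X Y = L2_set (\<lambda>ij. X $$ ij - Y $$ ij) ({..<n} \<times> {..<n})"

definition sym_topology :: "nat \<Rightarrow> real mat topology" where
  "sym_topology n = Metric_space.mtopology (sym_mats n) (frob_dist n)"

lemma Metric_space_sym_mats: "Metric_space (sym_mats n) (frob_dist n)"
proof
  fix X Y :: "real mat"
  show "0 \<le> frob_dist n X Y" by (simp add: frob_dist_def)
  show "frob_dist n X Y = frob_dist n Y X"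
    by (simp add: frob_dist_def L2_set_def power2_commute)
next
  fix X Y assume "X \<in> sym_mats n" "Y \<in> sym_mats n"
  then have c: "X \<in> carrier_mat n n" "Y \<in> carrier_mat n n"
    by (auto simp: sym_mats_def)
  show "(frob_dist n X Y = 0) = (X = Y)"
  proof
    assume "frob_dist n X Y = 0"
    then have "\<forall>ij\<in>{..<n} \<times> {..<n}. X $$ ij - Y $$ ij = 0"
      by (simp add: frob_dist_def L2_set_eq_0_iff)
    with c show "X = Y" by (intro eq_matI) auto
  next
    assume "X = Y"
    then show "frob_dist n X Y = 0" by (simp add: frob_dist_def L2_set_def)
  qed
next
  fix X Y Z :: "real mat"
  have "frob_dist n X Z
    = L2_set (\<lambda>ij. (X $$ ij - Y $$ ij) + (Y $$ ij - Z $$ ij)) ({..<n} \<times> {..<n})"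
    by (simp add: frob_dist_def)
  also have "\<dots> \<le> frob_dist n X Y + frob_dist n Y Z"
    unfolding frob_dist_def by (rule L2_set_triangle_ineq)
  finally show "frob_dist n X Z \<le> frob_dist n X Y + frob_dist n Y Z" .
qed

lemma frob_dist_eq_trace:
  assumes "X \<in> sym_mats n" "Y \<in> sym_mats n"
  shows "frob_dist n X Y = sqrt (mat_trace ((X - Y) * (X - Y)))"
proof -
  have c: "X \<in> carrier_mat n n" "Y \<in> carrier_mat n n"
    and s: "transpose_mat X = X" "transpose_mat Y = Y"
    using assms by (auto simp: sym_mats_def)
  have sx: "X $$ (j, i) = X $$ (i, j)" "Y $$ (j, i) = Y $$ (i, j)" if "i < n" "j < n" for i j
    using c s that by (metis carrier_matD index_transpose_mat(1))+
  have "mat_trace ((X - Y) * (X - Y))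
    = (\<Sum>i<n. \<Sum>j<n. (X $$ (i, j) - Y $$ (i, j)) * (X $$ (j, i) - Y $$ (j, i)))"
    using c by (auto simp: mat_trace_def scalar_prod_def atLeast0LessThan intro!: sum.cong)
  also have "\<dots> = (\<Sum>i<n. \<Sum>j<n. (X $$ (i, j) - Y $$ (i, j))\<^sup>2)"
    by (intro sum.cong refl) (auto simp: sx power2_eq_square)
  also have "\<dots> = (\<Sum>ij\<in>{..<n} \<times> {..<n}. (X $$ ij - Y $$ ij)\<^sup>2)"
    by (simp add: sum.cartesian_product case_prod_unfold)
  finally show ?thesis by (simp add: frob_dist_def L2_set_def)
qed

definition mat_cone :: "real mat set \<Rightarrow> bool" where
  "mat_cone K \<longleftrightarrow> (\<forall>X\<in>K. \<forall>c\<ge>0. c \<cdot>\<^sub>m X \<in> K)"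

definition mat_convex :: "real mat set \<Rightarrow> bool" where
  "mat_convex K \<longleftrightarrow>
     (\<forall>X\<in>K. \<forall>Y\<in>K. \<forall>u\<ge>0. \<forall>v\<ge>0. u + v = 1 \<longrightarrow> u \<cdot>\<^sub>m X + v \<cdot>\<^sub>m Y \<in> K)"

definition mat_pointed :: "nat \<Rightarrow> real mat set \<Rightarrow> bool" where
  "mat_pointed n K \<longleftrightarrow> (\<forall>X\<in>K. - X \<in> K \<longrightarrow> X = 0\<^sub>m n n)"

definition proper_cone :: "nat \<Rightarrow> real mat set \<Rightarrow> bool" where
  "proper_cone n K \<longleftrightarrow>
     K \<subseteq> sym_mats n \<and> mat_cone K \<and> mat_convex K \<and>
     closedin (sym_topology n) K \<and>
     (sym_topology n) interior_of K \<noteq> {} \<and>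
     mat_pointed n K"

end

(* The cone is a finite sum of the cones of positive semidefinite matrices supported on the index
   sets S_p = (block i) union (block j). For an abstract finite family of index sets, the dual
   consists of the symmetric X whose quadratic form is nonnegative on vectors supported in each S_p:
   test X against v v^T, and conversely split positive semidefinite matrices supported on S_p into
   rank-one ones. As there are at least two blocks, every pair of indices lies in some S_p, so a
   matrix close to I is a sum of positive semidefinite matrices supported on pairs {c, d}; this gives
   interior points of the cone and of the larger dual. In the same way the quadratic form on vectors
   supported on {c, d} determines every entry, so both cones are pointed. Closedness of the sum is a
   compactness argument. *)

theory Submission
  imports Defs
begin

section \<open>Quadratic forms of symmetric matrices\<close>

text \<open>Vectors are functions on all naturals, so supports and one-coordinate changes are
  handled pointwise; only values below \<open>n\<close> are read.\<close>

definition qform :: "nat \<Rightarrow> real mat \<Rightarrow> (nat \<Rightarrow> real) \<Rightarrow> real" where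
  "qform n X v = (\<Sum>a<n. \<Sum>b<n. v a * X $$ (a, b) * v b)"

lemma sym_matsD:
  assumes "X \<in> sym_mats n"
  shows "X \<in> carrier_mat n n" "transpose_mat X = X"
    "\<And>a b. a < n \<Longrightarrow> b < n \<Longrightarrow> X $$ (b, a) = X $$ (a, b)"
proof -
  show c: "X \<in> carrier_mat n n" and t: "transpose_mat X = X"
    using assms by (auto simp: sym_mats_def)
  show "X $$ (b, a) = X $$ (a, b)" if "a < n" "b < n" for a b
    using c t that by (metis carrier_matD index_transpose_mat(1))
qed

lemma sym_matsI:
  assumes "X \<in> carrier_mat n n" "\<And>a b. a < n \<Longrightarrow> b < n \<Longrightarrow> X $$ (b, a) = X $$ (a, b)"
  shows "X \<in> sym_mats n"
  using assms by (auto simp: sym_mats_def intro!: eq_matI)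

lemma scalar_prod_mult_vec_eq_qform:
  assumes "X \<in> carrier_mat n n" "v \<in> carrier_vec n"
  shows "scalar_prod v (X *\<^sub>v v) = qform n X (($) v)"
  using assms
  by (auto simp: qform_def scalar_prod_def sum_distrib_left atLeast0LessThan mult.assoc
      intro!: sum.cong)

lemma qform_cong:
  assumes "\<And>a. a < n \<Longrightarrow> u a = v a" "\<And>a b. a < n \<Longrightarrow> b < n \<Longrightarrow> X $$ (a, b) = Y $$ (a, b)"
  shows "qform n X u = qform n Y v"
  using assms by (auto simp: qform_def intro!: sum.cong)

text \<open>Truncating a function to \<open>vec n v\<close> does not change the form, so testing
  carrier vectors amounts to testing all functions.\<close>

lemma psd_mats_iff: "X \<in> psd_mats n \<longleftrightarrow> X \<in> sym_mats n \<and> (\<forall>v. 0 \<le> qform n X v)"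
proof -
  have "0 \<le> qform n X v"
    if X: "X \<in> sym_mats n" and "\<forall>v\<in>carrier_vec n. 0 \<le> scalar_prod v (X *\<^sub>v v)" for v
  proof -
    have "qform n X v = qform n X (($) (vec n v))" by (rule qform_cong) auto
    then show ?thesis
      using that(2)[rule_format, of "vec n v"]
        scalar_prod_mult_vec_eq_qform[OF sym_matsD(1)[OF X], of "vec n v"] by simp
  qed
  then show ?thesis
    by (auto simp: psd_mats_def scalar_prod_mult_vec_eq_qform[OF sym_matsD(1)])
qed

text \<open>The form of the product at \<open>v\<close> is the form of \<open>Y\<close> at
  \<open>A *\<^sub>v v\<close>.\<close>

lemma psd_mats_congruence:
  assumes Y: "Y \<in> psd_mats m" and A: "A \<in> carrier_mat m n"
  shows "transpose_mat A * Y * A \<in> psd_mats n"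
proof -
  have c: "Y \<in> carrier_mat m m" and t: "transpose_mat Y = Y"
    using Y sym_matsD by (auto simp: psd_mats_def)
  have "transpose_mat (transpose_mat A * Y * A) = transpose_mat A * Y * A"
  proof -
    have "transpose_mat (transpose_mat A * Y * A) = transpose_mat A * transpose_mat (transpose_mat A * Y)"
      using A c by (intro transpose_mult[of _ n m _ n]) auto
    also have "transpose_mat (transpose_mat A * Y) = Y * A"
      using A c t transpose_mult[of "transpose_mat A" n m Y m] by simp
    also have "transpose_mat A * (Y * A) = transpose_mat A * Y * A"
      using A c by (intro assoc_mult_mat[symmetric]) auto
    finally show ?thesis .
  qed
  moreover have "0 \<le> scalar_prod v ((transpose_mat A * Y * A) *\<^sub>v v)" if v: "v \<in> carrier_vec n" for v
  proof -
    have Av: "A *\<^sub>v v \<in> carrier_vec m" using A v by auto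
    have "(transpose_mat A * Y * A) *\<^sub>v v = transpose_mat A *\<^sub>v (Y *\<^sub>v (A *\<^sub>v v))"
      using A c v
      by (simp add: assoc_mult_mat_vec[of _ n m _ n] assoc_mult_mat_vec[of _ n m _ m]
          mult_carrier_mat[of _ n m _ m])
    then have "scalar_prod v ((transpose_mat A * Y * A) *\<^sub>v v)
        = scalar_prod (transpose_mat A *\<^sub>v (Y *\<^sub>v (A *\<^sub>v v))) v"
      using A c v by (simp add: comm_scalar_prod[of _ n])
    also have "\<dots> = scalar_prod (Y *\<^sub>v (A *\<^sub>v v)) (A *\<^sub>v v)"
      using A c v by (intro transpose_vec_mult_scalar) auto
    also have "\<dots> = scalar_prod (A *\<^sub>v v) (Y *\<^sub>v (A *\<^sub>v v))"
      using A c v by (intro comm_scalar_prod[of _ m]) auto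
    finally show ?thesis using Y Av by (simp add: psd_mats_def)
  qed
  ultimately show ?thesis using A c by (auto simp: psd_mats_def sym_mats_def)
qed

text \<open>Expand the form at u + t e_i; by symmetry the two cross terms coincide. This serves both
  two-point vectors and completing the square.\<close>

lemma qform_add_unit:
  assumes X: "X \<in> sym_mats n" and i: "i < n"
  shows "qform n X (\<lambda>c. u c + (if c = i then t else 0))
    = qform n X u + 2 * t * (\<Sum>b<n. X $$ (i, b) * u b) + t\<^sup>2 * X $$ (i, i)"
proof -
  let ?e = "\<lambda>c. if c = i then t else 0"
  have 1: "(\<Sum>a<n. \<Sum>b<n. ?e a * f a b) = t * (\<Sum>b<n. f i b)" for f
  proof -
    have "(\<Sum>a<n. \<Sum>b<n. ?e a * f a b) = (\<Sum>a<n. if a = i then t * (\<Sum>b<n. f a b) else 0)"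
      by (rule sum.cong) (auto simp: sum_distrib_left)
    then show ?thesis using i by simp
  qed
  have 2: "(\<Sum>a<n. \<Sum>b<n. f a b * ?e b) = t * (\<Sum>a<n. f a i)" for f
    using 1[of "\<lambda>a b. f b a"] by (subst sum.swap) (simp add: mult.commute)
  have "qform n X (\<lambda>c. u c + ?e c) = qform n X u
      + (\<Sum>a<n. \<Sum>b<n. ?e a * (X $$ (a, b) * u b))
      + (\<Sum>a<n. \<Sum>b<n. (u a * X $$ (a, b)) * ?e b)
      + (\<Sum>a<n. \<Sum>b<n. ?e a * (X $$ (a, b) * ?e b))"
    unfolding qform_def sum.distrib[symmetric]
    by (intro sum.cong refl) (simp add: algebra_simps)
  also have "(\<Sum>a<n. u a * X $$ (a, i)) = (\<Sum>b<n. X $$ (i, b) * u b)"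
    using sym_matsD(3)[OF X] i by (intro sum.cong) auto
  then have "(\<Sum>a<n. \<Sum>b<n. (u a * X $$ (a, b)) * ?e b) = t * (\<Sum>b<n. X $$ (i, b) * u b)"
    unfolding 2 by simp
  also have "(\<Sum>a<n. \<Sum>b<n. ?e a * (X $$ (a, b) * ?e b)) = t\<^sup>2 * X $$ (i, i)"
    unfolding 1 using i by (simp add: power2_eq_square if_distrib[of "\<lambda>x. _ * x"] cong: if_cong)
  finally show ?thesis unfolding 1 by simp
qed

lemma qform_two_point:
  assumes X: "X \<in> sym_mats n" and i: "i < n" "j < n"
  shows "qform n X (\<lambda>c. (if c = j then s else 0) + (if c = i then t else 0))
    = s\<^sup>2 * X $$ (j, j) + 2 * s * t * X $$ (i, j) + t\<^sup>2 * X $$ (i, i)"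
proof -
  have "qform n X (\<lambda>c. if c = j then s else 0) = s\<^sup>2 * X $$ (j, j)"
    using qform_add_unit[OF X i(2), of "\<lambda>_. 0" s] by (simp add: qform_def)
  moreover have "(\<Sum>b<n. X $$ (i, b) * (if b = j then s else 0)) = X $$ (i, j) * s"
    using i by (simp add: if_distrib[of "\<lambda>x. _ * x"] cong: if_cong)
  ultimately show ?thesis unfolding qform_add_unit[OF X i(1)] by simp
qed

section \<open>Bounds on the entries of positive semidefinite matrices\<close>

lemma psd_two_point:
  assumes X: "X \<in> psd_mats n" and i: "i < n" "j < n"
  shows "0 \<le> s\<^sup>2 * X $$ (j, j) + 2 * s * t * X $$ (i, j) + t\<^sup>2 * X $$ (i, i)"
proof -
  have Xs: "X \<in> sym_mats n" and nn: "0 \<le> qform n X v" for v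
    using X by (auto simp: psd_mats_iff)
  show ?thesis using nn unfolding qform_two_point[OF Xs i, symmetric] .
qed

lemma psd_diag_nonneg:
  assumes "X \<in> psd_mats n" "i < n"
  shows "0 \<le> X $$ (i, i)"
  using psd_two_point[OF assms(1) assms(2) assms(2), of 0 1] by simp

text \<open>Test the form on e_j + e_i and on e_j - e_i. This bound later confines all entries of
  the summands once their diagonals are bounded.\<close>

lemma psd_entry_bound:
  assumes "X \<in> psd_mats n" "i < n" "j < n"
  shows "\<bar>X $$ (i, j)\<bar> \<le> (X $$ (i, i) + X $$ (j, j)) / 2"
  using psd_two_point[OF assms, of 1 1] psd_two_point[OF assms, of 1 "-1"] by (simp add: abs_le_iff)

text \<open>With a zero diagonal entry the two-point form at s = 1 is affine in t, and an affine
  function bounded below has slope zero.\<close>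

lemma psd_zero_diag_row:
  assumes X: "X \<in> psd_mats n" and ij: "i < n" "j < n" and 0: "X $$ (i, i) = 0"
  shows "X $$ (i, j) = 0"
proof (rule ccontr)
  assume ne: "X $$ (i, j) \<noteq> 0"
  \<comment> \<open>At this t the affine function takes the value -1.\<close>
  define t where "t = - (X $$ (j, j) + 1) / (2 * X $$ (i, j))"
  have "0 \<le> 1\<^sup>2 * X $$ (j, j) + 2 * 1 * t * X $$ (i, j) + t\<^sup>2 * X $$ (i, i)"
    by (rule psd_two_point[OF X ij])
  moreover have "2 * t * X $$ (i, j) = - (X $$ (j, j) + 1)" using ne by (simp add: t_def)
  ultimately show False using 0 by simp
qed

section \<open>Positive semidefinite matrices with restricted support\<close>

text \<open>Only the rows outside \<open>S\<close> are required to vanish; symmetry takes care of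
  the columns.\<close>

definition supp_psd :: "nat \<Rightarrow> nat set \<Rightarrow> real mat set" where
  "supp_psd n S = {W \<in> psd_mats n. \<forall>a<n. \<forall>b<n. a \<notin> S \<longrightarrow> W $$ (a, b) = 0}"

lemma supp_psdD:
  assumes "W \<in> supp_psd n S"
  shows "W \<in> psd_mats n" "W \<in> sym_mats n"
    "\<And>a b. a < n \<Longrightarrow> b < n \<Longrightarrow> a \<notin> S \<or> b \<notin> S \<Longrightarrow> W $$ (a, b) = 0"
proof -
  show "W \<in> psd_mats n" and s: "W \<in> sym_mats n"
    using assms by (auto simp: supp_psd_def psd_mats_def)
  show "W $$ (a, b) = 0" if "a < n" "b < n" "a \<notin> S \<or> b \<notin> S" for a b
    using assms that sym_matsD(3)[OF s, of a b] by (auto simp: supp_psd_def)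
qed

lemma qform_lincomb:
  assumes "\<And>a b. a < n \<Longrightarrow> b < n \<Longrightarrow> X $$ (a, b) = (\<Sum>i\<in>I. c i * W i $$ (a, b))"
  shows "qform n X v = (\<Sum>i\<in>I. c i * qform n (W i) v)"
proof -
  have "qform n X v = (\<Sum>a<n. \<Sum>b<n. \<Sum>i\<in>I. c i * (v a * W i $$ (a, b) * v b))"
    by (auto simp: qform_def assms sum_distrib_left sum_distrib_right algebra_simps
        intro!: sum.cong)
  also have "\<dots> = (\<Sum>a<n. \<Sum>i\<in>I. \<Sum>b<n. c i * (v a * W i $$ (a, b) * v b))"
    by (intro sum.cong refl sum.swap)
  also have "\<dots> = (\<Sum>i\<in>I. \<Sum>a<n. \<Sum>b<n. c i * (v a * W i $$ (a, b) * v b))"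
    by (rule sum.swap)
  also have "\<dots> = (\<Sum>i\<in>I. c i * qform n (W i) v)"
    by (simp add: qform_def sum_distrib_left)
  finally show ?thesis .
qed

lemma supp_psd_lincomb:
  assumes W: "\<And>i. i \<in> I \<Longrightarrow> W i \<in> supp_psd n S" and c: "\<And>i. i \<in> I \<Longrightarrow> 0 \<le> c i"
  shows "mat n n (\<lambda>(a, b). \<Sum>i\<in>I. c i * W i $$ (a, b)) \<in> supp_psd n S" (is "?M \<in> _")
proof -
  have "?M \<in> sym_mats n"
    using sym_matsD(3)[OF supp_psdD(2)[OF W]] by (intro sym_matsI) (auto intro!: sum.cong)
  moreover have "0 \<le> qform n ?M v" for v
  proof -
    have "qform n ?M v = (\<Sum>i\<in>I. c i * qform n (W i) v)" by (rule qform_lincomb) auto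
    then show ?thesis
      using W c by (auto simp: supp_psd_def psd_mats_iff intro!: sum_nonneg)
  qed
  moreover have "?M $$ (a, b) = 0" if "a < n" "b < n" "a \<notin> S" for a b
    using that supp_psdD(3)[OF W] by (auto intro!: sum.neutral)
  ultimately show ?thesis by (simp add: supp_psd_def psd_mats_iff)
qed

text \<open>Eliminating one nonzero diagonal entry at a time (symmetric Gaussian elimination)
  splits \<open>W\<close> into rank-one matrices whose vectors are rows of \<open>W\<close> and hence still
  supported in \<open>S\<close>.\<close>

lemma supp_psd_pairing_nonneg:
  assumes "W \<in> supp_psd n S" and X: "\<And>v. (\<And>a. a \<notin> S \<Longrightarrow> v a = 0) \<Longrightarrow> 0 \<le> qform n X v"
  shows "0 \<le> (\<Sum>a<n. \<Sum>b<n. X $$ (a, b) * W $$ (a, b))"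
  using assms(1)
proof (induction "card {i. i < n \<and> W $$ (i, i) \<noteq> 0}" arbitrary: W rule: less_induct)
  case less
  note W = supp_psdD[OF less.prems]
  show ?case
  proof (cases "\<exists>i<n. W $$ (i, i) \<noteq> 0")
    case False
    then have "W $$ (a, b) = 0" if "a < n" "b < n" for a b
      using that psd_zero_diag_row[OF W(1)] by blast
    then show ?thesis by simp
  next
    case True
    then obtain i where i: "i < n" "W $$ (i, i) \<noteq> 0" by blast
    define d where "d = W $$ (i, i)"
    have d: "d > 0" using i psd_diag_nonneg[OF W(1), of i] by (simp add: d_def)
    \<comment> \<open>Row i of \<open>W\<close>, extended by zero beyond \<open>n\<close> because
      the hypothesis on \<open>X\<close> asks for vanishing at every index outside
      \<open>S\<close>.\<close>
    define w where "w a = (if a < n then W $$ (i, a) else 0)" for a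
    \<comment> \<open>The Schur complement W - w w^T / d, whose row and column i vanish.\<close>
    define W' where "W' = mat n n (\<lambda>(a, b). W $$ (a, b) - w a * w b / d)"
    have W'e: "W' $$ (a, b) = W $$ (a, b) - w a * w b / d" if "a < n" "b < n" for a b
      using that by (simp add: W'_def)
    have w0: "w a = 0" if "a \<notin> S" for a using that i W(3)[of i a] by (auto simp: w_def)
    have sym: "W' \<in> sym_mats n"
      using sym_matsD(3)[OF W(2)] by (intro sym_matsI) (auto simp: W'_def mult.commute)
    have rank1: "(\<Sum>a<n. \<Sum>b<n. f a * (w a * w b / d) * f b) = (\<Sum>b<n. w b * f b)\<^sup>2 / d" for f
      by (simp add: power2_eq_square sum_product sum_divide_distrib algebra_simps)
    have q: "0 \<le> qform n W' u" for u
    proof -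
      \<comment> \<open>The minimiser over t of the form of \<open>W\<close> at u + t e_i; the
        minimum is the form of \<open>W'\<close> at \<open>u\<close>.\<close>
      define t where "t = - (\<Sum>b<n. w b * u b) / d"
      have row: "(\<Sum>b<n. W $$ (i, b) * u b) = (\<Sum>b<n. w b * u b)"
        by (intro sum.cong) (auto simp: w_def)
      have "0 \<le> qform n W (\<lambda>c. u c + (if c = i then t else 0))"
        using W(1) unfolding psd_mats_iff by blast
      also have "\<dots> = qform n W u + 2 * t * (\<Sum>b<n. w b * u b) + t\<^sup>2 * d"
        unfolding qform_add_unit[OF W(2) i(1)] row d_def ..
      also have "\<dots> = qform n W u - (\<Sum>b<n. w b * u b)\<^sup>2 / d"
        using d by (simp add: t_def power2_eq_square field_simps)
      also have "\<dots> = qform n W' u"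
        unfolding rank1[symmetric] qform_def sum_subtractf[symmetric]
        by (intro sum.cong refl) (simp add: W'e algebra_simps)
      finally show ?thesis .
    qed
    have supp: "W' \<in> supp_psd n S"
      using sym q W(3) w0 by (auto simp: supp_psd_def psd_mats_iff W'e)
    \<comment> \<open>Zero diagonal entries stay zero since their whole row in \<open>W\<close>
      vanishes, and entry i becomes d - d^2 / d = 0.\<close>
    have "{j. j < n \<and> W' $$ (j, j) \<noteq> 0} \<subset> {j. j < n \<and> W $$ (j, j) \<noteq> 0}"
    proof
      show "{j. j < n \<and> W' $$ (j, j) \<noteq> 0} \<subseteq> {j. j < n \<and> W $$ (j, j) \<noteq> 0}"
      proof safe
        fix j assume j: "j < n" "W' $$ (j, j) \<noteq> 0" "W $$ (j, j) = 0"
        then have "W $$ (j, i) = 0" using psd_zero_diag_row[OF W(1)] i by blast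
        then have "w j = 0" using sym_matsD(3)[OF W(2), of i j] i j by (simp add: w_def)
        then show False using j by (simp add: W'e)
      qed
      show "{j. j < n \<and> W' $$ (j, j) \<noteq> 0} \<noteq> {j. j < n \<and> W $$ (j, j) \<noteq> 0}"
      proof -
        have "W' $$ (i, i) = 0" using i by (simp add: W'e w_def d_def)
        then show ?thesis using i by blast
      qed
    qed
    then have "card {j. j < n \<and> W' $$ (j, j) \<noteq> 0} < card {j. j < n \<and> W $$ (j, j) \<noteq> 0}"
      by (intro psubset_card_mono) auto
    then have IH: "0 \<le> (\<Sum>a<n. \<Sum>b<n. X $$ (a, b) * W' $$ (a, b))"
      using less.hyps supp by blast
    \<comment> \<open>The removed rank-one part contributes w^T X w / d, which is nonnegative
      because \<open>w\<close> is supported in \<open>S\<close>.\<close>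
    have "(\<Sum>a<n. \<Sum>b<n. X $$ (a, b) * W $$ (a, b))
        = (\<Sum>a<n. \<Sum>b<n. X $$ (a, b) * W' $$ (a, b)) + qform n X w / d"
      unfolding qform_def sum_divide_distrib sum.distrib[symmetric]
      by (intro sum.cong refl) (simp add: W'e field_simps)
    then show ?thesis using IH X[of w] w0 d by simp
  qed
qed

section \<open>Cones generated by positive semidefinite matrices with prescribed supports\<close>

text \<open>The supports form an abstract indexed family, so that duality and closedness can be
  proved without block arithmetic. The sum is stated entrywise to avoid group sums of
  matrices.\<close>

definition sparse_cone :: "nat \<Rightarrow> 'i set \<Rightarrow> ('i \<Rightarrow> nat set) \<Rightarrow> real mat set" where
  "sparse_cone n P S = {Z \<in> sym_mats n. \<exists>W. (\<forall>p\<in>P. W p \<in> supp_psd n (S p)) \<and>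
     (\<forall>a<n. \<forall>b<n. Z $$ (a, b) = (\<Sum>p\<in>P. W p $$ (a, b)))}"

text \<open>The candidate for the dual: each principal submatrix indexed by some \<open>S p\<close>
  is positive semidefinite, expressed without forming that submatrix.\<close>

definition local_psd :: "nat \<Rightarrow> 'i set \<Rightarrow> ('i \<Rightarrow> nat set) \<Rightarrow> real mat set" where
  "local_psd n P S = {X \<in> sym_mats n. \<forall>p\<in>P. \<forall>v. (\<forall>a. a \<notin> S p \<longrightarrow> v a = 0) \<longrightarrow> 0 \<le> qform n X v}"

text \<open>Combine the summands belonging to the same support and exchange the sums. Scaling,
  convex combinations and the decomposition near the identity are all instances.\<close>

lemma sparse_cone_lincomb:
  assumes M: "\<And>i. i \<in> I \<Longrightarrow> M i \<in> sparse_cone n P S" and c: "\<And>i. i \<in> I \<Longrightarrow> 0 \<le> c i"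
    and Z: "Z \<in> carrier_mat n n"
      "\<And>a b. a < n \<Longrightarrow> b < n \<Longrightarrow> Z $$ (a, b) = (\<Sum>i\<in>I. c i * M i $$ (a, b))"
  shows "Z \<in> sparse_cone n P S"
proof -
  have "\<forall>i\<in>I. \<exists>W. (\<forall>p\<in>P. W p \<in> supp_psd n (S p)) \<and>
     (\<forall>a<n. \<forall>b<n. M i $$ (a, b) = (\<Sum>p\<in>P. W p $$ (a, b)))"
    using M by (auto simp: sparse_cone_def)
  from bchoice[OF this] obtain W where W: "\<And>i p. i \<in> I \<Longrightarrow> p \<in> P \<Longrightarrow> W i p \<in> supp_psd n (S p)"
    "\<And>i a b. i \<in> I \<Longrightarrow> a < n \<Longrightarrow> b < n \<Longrightarrow> M i $$ (a, b) = (\<Sum>p\<in>P. W i p $$ (a, b))"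
    by blast
  define V where "V p = mat n n (\<lambda>(a, b). \<Sum>i\<in>I. c i * W i p $$ (a, b))" for p
  have "V p \<in> supp_psd n (S p)" if "p \<in> P" for p
    unfolding V_def using W(1) that c by (intro supp_psd_lincomb) auto
  moreover have "Z $$ (a, b) = (\<Sum>p\<in>P. V p $$ (a, b))" if "a < n" "b < n" for a b
  proof -
    have "Z $$ (a, b) = (\<Sum>i\<in>I. \<Sum>p\<in>P. c i * W i p $$ (a, b))"
      using that by (simp add: Z W(2) sum_distrib_left)
    also have "\<dots> = (\<Sum>p\<in>P. \<Sum>i\<in>I. c i * W i p $$ (a, b))" by (rule sum.swap)
    finally show ?thesis using that by (simp add: V_def)
  qed
  moreover have "Z \<in> sym_mats n"
  proof (rule sym_matsI[OF Z(1)])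
    show "Z $$ (b, a) = Z $$ (a, b)" if "a < n" "b < n" for a b
    proof -
      have "M i $$ (b, a) = M i $$ (a, b)" if "i \<in> I" for i
        using M[OF that] sym_matsD(3)[of "M i" n a b] \<open>a < n\<close> \<open>b < n\<close> by (simp add: sparse_cone_def)
      then show ?thesis using that by (simp add: Z)
    qed
  qed
  ultimately show ?thesis by (auto simp: sparse_cone_def)
qed

lemma supp_psd_subset_sparse_cone:
  assumes "finite P" "p \<in> P"
  shows "supp_psd n (S p) \<subseteq> sparse_cone n P S"
proof
  fix W assume W: "W \<in> supp_psd n (S p)"
  \<comment> \<open>The empty nonnegative combination is the zero matrix.\<close>
  have "0\<^sub>m n n \<in> supp_psd n T" for T
    using supp_psd_lincomb[of "{}" undefined n T undefined] by (simp add: zero_mat_def case_prod_unfold)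
  then have "\<forall>q\<in>P. (if q = p then W else 0\<^sub>m n n) \<in> supp_psd n (S q)"
    using W by auto
  moreover have "W $$ (a, b) = (\<Sum>q\<in>P. (if q = p then W else 0\<^sub>m n n) $$ (a, b))"
    if "a < n" "b < n" for a b
    using assms that by (simp add: if_distrib[of "\<lambda>M. M $$ _"] cong: if_cong)
  ultimately show "W \<in> sparse_cone n P S"
    using supp_psdD(2)[OF W] unfolding sparse_cone_def
    by (intro CollectI conjI exI[of _ "\<lambda>q. if q = p then W else 0\<^sub>m n n"]) auto
qed

text \<open>A sum of positive semidefinite matrices is positive semidefinite, so it passes the test
  for any family of supports. With equal families, the cone lies in its dual.\<close>

lemma sparse_cone_subset_local_psd: "sparse_cone n P S \<subseteq> local_psd n Q T"
proof
  fix Z assume "Z \<in> sparse_cone n P S"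
  then obtain W where Z: "Z \<in> sym_mats n" and W: "\<forall>p\<in>P. W p \<in> supp_psd n (S p)"
    "\<And>a b. a < n \<Longrightarrow> b < n \<Longrightarrow> Z $$ (a, b) = (\<Sum>p\<in>P. W p $$ (a, b))"
    by (auto simp: sparse_cone_def)
  have "qform n Z v = (\<Sum>p\<in>P. 1 * qform n (W p) v)" for v
    by (rule qform_lincomb) (simp add: W)
  then have "0 \<le> qform n Z v" for v
    using W by (auto simp: supp_psd_def psd_mats_iff intro!: sum_nonneg)
  then show "Z \<in> local_psd n Q T" using Z by (auto simp: local_psd_def)
qed

section \<open>Trace pairing and the dual cone\<close>

lemma mat_trace_mult_sym:
  assumes "X \<in> carrier_mat n n" "Z \<in> sym_mats n"
  shows "mat_trace (X * Z) = (\<Sum>a<n. \<Sum>b<n. X $$ (a, b) * Z $$ (a, b))"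
proof -
  have "mat_trace (X * Z) = (\<Sum>a<n. \<Sum>b<n. X $$ (a, b) * Z $$ (b, a))"
    using assms sym_matsD(1)[OF assms(2)]
    by (auto simp: mat_trace_def scalar_prod_def atLeast0LessThan intro!: sum.cong)
  also have "\<dots> = (\<Sum>a<n. \<Sum>b<n. X $$ (a, b) * Z $$ (a, b))"
    using sym_matsD(3)[OF assms(2)] by (intro sum.cong) auto
  finally show ?thesis .
qed

lemma dual_sparse_cone:
  assumes "finite P"
  shows "dual_cone n (sparse_cone n P S) = local_psd n P S"
proof (intro equalityI subsetI)
  fix X assume "X \<in> dual_cone n (sparse_cone n P S)"
  then have X: "X \<in> sym_mats n" and tr: "\<And>Z. Z \<in> sparse_cone n P S \<Longrightarrow> 0 \<le> mat_trace (X * Z)"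
    by (auto simp: dual_cone_def)
  have "0 \<le> qform n X v" if p: "p \<in> P" and v: "\<forall>a. a \<notin> S p \<longrightarrow> v a = 0" for p v
  proof -
    \<comment> \<open>The rank-one matrix v v^T lies in the cone, and its trace pairing with
      \<open>X\<close> is the form of \<open>X\<close> at \<open>v\<close>.\<close>
    define Z where "Z = mat n n (\<lambda>(a, b). v a * v b)"
    have Zs: "Z \<in> sym_mats n" by (intro sym_matsI) (auto simp: Z_def)
    have "qform n Z u = (\<Sum>a<n. u a * v a)\<^sup>2" for u
      by (simp add: Z_def qform_def power2_eq_square sum_product algebra_simps)
    then have "Z \<in> supp_psd n (S p)"
      using Zs v by (auto simp: supp_psd_def psd_mats_iff Z_def)
    then have "Z \<in> sparse_cone n P S" using supp_psd_subset_sparse_cone[OF assms p] by auto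
    then have "0 \<le> (\<Sum>a<n. \<Sum>b<n. X $$ (a, b) * Z $$ (a, b))"
      using tr[of Z] mat_trace_mult_sym[OF sym_matsD(1)[OF X] Zs] by simp
    also have "\<dots> = qform n X v"
      by (simp add: Z_def qform_def algebra_simps)
    finally show ?thesis .
  qed
  then show "X \<in> local_psd n P S" using X by (auto simp: local_psd_def)
next
  fix X assume X: "X \<in> local_psd n P S"
  then have Xs: "X \<in> sym_mats n" by (simp add: local_psd_def)
  have "0 \<le> mat_trace (X * Z)" if "Z \<in> sparse_cone n P S" for Z
  proof -
    obtain W where Z: "Z \<in> sym_mats n" and W: "\<forall>p\<in>P. W p \<in> supp_psd n (S p)"
      "\<And>a b. a < n \<Longrightarrow> b < n \<Longrightarrow> Z $$ (a, b) = (\<Sum>p\<in>P. W p $$ (a, b))"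
      using \<open>Z \<in> sparse_cone n P S\<close> by (auto simp: sparse_cone_def)
    have "mat_trace (X * Z) = (\<Sum>a<n. \<Sum>b<n. \<Sum>p\<in>P. X $$ (a, b) * W p $$ (a, b))"
      unfolding mat_trace_mult_sym[OF sym_matsD(1)[OF Xs] Z]
      by (intro sum.cong refl) (simp add: W sum_distrib_left)
    also have "\<dots> = (\<Sum>a<n. \<Sum>p\<in>P. \<Sum>b<n. X $$ (a, b) * W p $$ (a, b))"
      by (intro sum.cong refl sum.swap)
    also have "\<dots> = (\<Sum>p\<in>P. \<Sum>a<n. \<Sum>b<n. X $$ (a, b) * W p $$ (a, b))"
      by (rule sum.swap)
    \<comment> \<open>The pairing now splits over the supports, and each part is nonnegative by the
      rank-one elimination argument.\<close>
    also have "\<dots> \<ge> 0"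
      using W X by (intro sum_nonneg supp_psd_pairing_nonneg) (auto simp: local_psd_def)
    finally show ?thesis .
  qed
  then show "X \<in> dual_cone n (sparse_cone n P S)" using Xs by (auto simp: dual_cone_def)
qed

section \<open>Topology of symmetric matrices\<close>

lemma entry_dist_le_frob_dist:
  assumes "a < n" "b < n"
  shows "\<bar>X $$ (a, b) - Y $$ (a, b)\<bar> \<le> frob_dist n X Y"
proof -
  have "\<bar>X $$ (a, b) - Y $$ (a, b)\<bar> = sqrt ((X $$ (a, b) - Y $$ (a, b))\<^sup>2)" by simp
  also have "\<dots> \<le> frob_dist n X Y"
    unfolding frob_dist_def L2_set_def
    using assms by (intro real_sqrt_le_mono member_le_sum[where i="(a, b)"]) auto
  finally show ?thesis .
qed

lemma limitin_sym_topology_entry: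
  assumes "limitin (sym_topology n) \<sigma> Z sequentially" "a < n" "b < n"
  shows "(\<lambda>k. \<sigma> k $$ (a, b)) \<longlonglongrightarrow> Z $$ (a, b)"
proof (rule LIMSEQ_I)
  fix e :: real assume "e > 0"
  then obtain N where "\<forall>k\<ge>N. frob_dist n (\<sigma> k) Z < e"
    using assms(1) unfolding sym_topology_def
      Metric_space.limit_metric_sequentially[OF Metric_space_sym_mats] by blast
  then show "\<exists>N. \<forall>k\<ge>N. norm (\<sigma> k $$ (a, b) - Z $$ (a, b)) < e"
    using entry_dist_le_frob_dist[OF assms(2,3), of "\<sigma> _" Z]
    by (metis order_le_less_trans real_norm_def)
qed

text \<open>In a metric space sequences detect closedness, and Frobenius convergence implies
  entrywise convergence, which is all that later arguments use.\<close>

lemma closedin_sym_topologyI: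
  assumes "K \<subseteq> sym_mats n"
    and "\<And>\<sigma> Z. (\<And>k. \<sigma> k \<in> K) \<Longrightarrow> Z \<in> sym_mats n \<Longrightarrow>
      (\<And>a b. a < n \<Longrightarrow> b < n \<Longrightarrow> (\<lambda>k. \<sigma> k $$ (a, b)) \<longlonglongrightarrow> Z $$ (a, b)) \<Longrightarrow> Z \<in> K"
  shows "closedin (sym_topology n) K"
  unfolding sym_topology_def Metric_space.metric_closedin_iff_sequentially_closed[OF Metric_space_sym_mats]
proof (intro conjI allI impI assms(1))
  fix \<sigma> l
  assume *: "range \<sigma> \<subseteq> K \<and>
    limitin (Metric_space.mtopology (sym_mats n) (frob_dist n)) \<sigma> l sequentially"
  then have l: "l \<in> sym_mats n"
    using Metric_space.limit_metric_sequentially[OF Metric_space_sym_mats] by blast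
  show "l \<in> K"
  proof (rule assms(2)[OF _ l])
    show "\<sigma> k \<in> K" for k using * by blast
    show "(\<lambda>k. \<sigma> k $$ (a, b)) \<longlonglongrightarrow> l $$ (a, b)" if "a < n" "b < n" for a b
      using * limitin_sym_topology_entry[OF _ that] unfolding sym_topology_def by blast
  qed
qed

lemma tendsto_qform:
  assumes "\<And>a b. a < n \<Longrightarrow> b < n \<Longrightarrow> (\<lambda>k. \<sigma> k $$ (a, b)) \<longlonglongrightarrow> Z $$ (a, b)"
  shows "(\<lambda>k. qform n (\<sigma> k) v) \<longlonglongrightarrow> qform n Z v"
  unfolding qform_def by (intro tendsto_sum tendsto_mult tendsto_const assms) auto

text \<open>For fixed \<open>v\<close> the form is a finite sum of entries with constant weights, so
  its nonnegativity passes to limits.\<close>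

lemma closedin_local_psd: "closedin (sym_topology n) (local_psd n P S)"
proof (rule closedin_sym_topologyI)
  show "local_psd n P S \<subseteq> sym_mats n" by (auto simp: local_psd_def)
  fix \<sigma> Z assume s: "\<And>k. \<sigma> k \<in> local_psd n P S" "Z \<in> sym_mats n"
    and l: "\<And>a b. a < n \<Longrightarrow> b < n \<Longrightarrow> (\<lambda>k. \<sigma> k $$ (a, b)) \<longlonglongrightarrow> Z $$ (a, b)"
  have "0 \<le> qform n Z v" if "p \<in> P" "\<forall>a. a \<notin> S p \<longrightarrow> v a = 0" for p v
    using tendsto_qform[of n \<sigma> Z v, OF l] s(1) that
    by (intro LIMSEQ_le_const) (auto simp: local_psd_def)
  then show "Z \<in> local_psd n P S" using s by (auto simp: local_psd_def)
qed

text \<open>Bolzano-Weierstrass in finitely many coordinates: each induction step passes to a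
  further subsequence that is monotone in the new coordinate, and the earlier coordinates keep
  converging.\<close>

lemma bounded_real_family_convergent_subseq:
  fixes f :: "'i \<Rightarrow> nat \<Rightarrow> real"
  assumes "finite I" "\<And>i. i \<in> I \<Longrightarrow> Bseq (f i)"
  shows "\<exists>r. strict_mono r \<and> (\<forall>i\<in>I. convergent (f i \<circ> r))"
  using assms
proof (induction I)
  case empty
  show ?case using strict_mono_id by blast
next
  case (insert j I)
  have "\<And>i. i \<in> I \<Longrightarrow> Bseq (f i)" by (rule insert.prems) simp
  from insert.IH[OF this] obtain r where r: "strict_mono r" "\<forall>i\<in>I. convergent (f i \<circ> r)"
    by blast
  obtain s where s: "strict_mono s" "monoseq (\<lambda>k. (f j \<circ> r) (s k))"
    using seq_monosub[of "f j \<circ> r"] by blast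
  have "Bseq (f j)" using insert.prems by blast
  then have "Bseq (\<lambda>k. (f j \<circ> r) (s k))" unfolding Bseq_def comp_apply by blast
  from Bseq_monoseq_convergent[OF this s(2)] have "convergent (f j \<circ> (r \<circ> s))"
    by (simp add: comp_def)
  moreover have "\<forall>i\<in>I. convergent (f i \<circ> (r \<circ> s))"
    using convergent_subseq_convergent[OF _ s(1)] r(2) unfolding comp_assoc[symmetric] by blast
  ultimately show ?case using strict_mono_o[OF r(1) s(1)] by blast
qed

text \<open>The summands have nonnegative diagonals, so the diagonal of the sum bounds the diagonal of
  every summand, and therefore all of its entries: the summands stay in a compact set.\<close>

lemma closedin_sparse_cone:
  assumes "finite P"
  shows "closedin (sym_topology n) (sparse_cone n P S)"
proof (rule closedin_sym_topologyI)
  show "sparse_cone n P S \<subseteq> sym_mats n" by (auto simp: sparse_cone_def)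
  fix \<sigma> Z assume s: "\<And>k. \<sigma> k \<in> sparse_cone n P S" and Z: "Z \<in> sym_mats n"
    and l: "\<And>a b. a < n \<Longrightarrow> b < n \<Longrightarrow> (\<lambda>k. \<sigma> k $$ (a, b)) \<longlonglongrightarrow> Z $$ (a, b)"
  have "\<forall>k. \<exists>W. (\<forall>p\<in>P. W p \<in> supp_psd n (S p)) \<and>
     (\<forall>a<n. \<forall>b<n. \<sigma> k $$ (a, b) = (\<Sum>p\<in>P. W p $$ (a, b)))"
    using s by (auto simp: sparse_cone_def)
  from choice[OF this] obtain W where W: "\<And>k p. p \<in> P \<Longrightarrow> W k p \<in> supp_psd n (S p)"
    "\<And>k a b. a < n \<Longrightarrow> b < n \<Longrightarrow> \<sigma> k $$ (a, b) = (\<Sum>p\<in>P. W k p $$ (a, b))"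
    by blast
  \<comment> \<open>All entries of all summands form one finite family of real sequences, so a
    single subsequence serves them together.\<close>
  define f where "f = (\<lambda>(p, a, b) k. W k p $$ (a, b))"
  have diag: "W k p $$ (a, a) \<le> \<sigma> k $$ (a, a)" if "p \<in> P" "a < n" for k p a
    unfolding W(2)[OF that(2) that(2)]
    using that assms psd_diag_nonneg[OF supp_psdD(1)[OF W(1)]] by (intro member_le_sum) auto
  have bseq: "Bseq (f (p, a, b))" if p: "p \<in> P" and ab: "a < n" "b < n" for p a b
  proof -
    have "(\<lambda>k. (\<sigma> k $$ (a, a) + \<sigma> k $$ (b, b)) / 2) \<longlonglongrightarrow> (Z $$ (a, a) + Z $$ (b, b)) / 2"
      by (intro tendsto_divide tendsto_add l ab tendsto_const) simp
    then have conv: "convergent (\<lambda>k. (\<sigma> k $$ (a, a) + \<sigma> k $$ (b, b)) / 2)"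
      by (rule convergentI)
    \<comment> \<open>An entry of a summand is at most the mean of two of its diagonal entries,
      which the diagonal of the sum dominates.\<close>
    have "norm (f (p, a, b) k) \<le> norm ((\<sigma> k $$ (a, a) + \<sigma> k $$ (b, b)) / 2)" for k
      using psd_entry_bound[OF supp_psdD(1)[OF W(1)] ab, OF p, of k] diag[OF p ab(1), of k]
        diag[OF p ab(2), of k] by (simp add: f_def)
    then have "\<forall>\<^sub>F k in sequentially. norm (f (p, a, b) k) \<le> norm ((\<sigma> k $$ (a, a) + \<sigma> k $$ (b, b)) / 2)"
      by simp
    then show ?thesis by (rule Bseq_eventually_mono) (rule convergent_imp_Bseq[OF conv])
  qed
  have "\<exists>r. strict_mono r \<and> (\<forall>x\<in>P \<times> {..<n} \<times> {..<n}. convergent (f x \<circ> r))"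
    using assms bseq by (intro bounded_real_family_convergent_subseq) auto
  then obtain r where r: "strict_mono r"
    and conv: "\<forall>x\<in>P \<times> {..<n} \<times> {..<n}. convergent (f x \<circ> r)" by blast
  define V where "V p = mat n n (\<lambda>(a, b). lim (f (p, a, b) \<circ> r))" for p
  have V: "(\<lambda>k. W (r k) p $$ (a, b)) \<longlonglongrightarrow> V p $$ (a, b)" if "p \<in> P" "a < n" "b < n" for p a b
  proof -
    have "(f (p, a, b) \<circ> r) \<longlonglongrightarrow> lim (f (p, a, b) \<circ> r)"
      using conv that by (auto simp: convergent_LIMSEQ_iff)
    then show ?thesis using that by (simp add: V_def f_def comp_def)
  qed
  \<comment> \<open>Symmetry, nonnegativity of the form and vanishing entries are all preserved by
    entrywise limits.\<close>
  have "V p \<in> supp_psd n (S p)" if p: "p \<in> P" for p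
  proof -
    note Wp = supp_psdD[OF W(1)[OF p]]
    have "V p $$ (b, a) = V p $$ (a, b)" if "a < n" "b < n" for a b
      using V[OF p that] V[OF p that(2,1)] sym_matsD(3)[OF Wp(2) that]
      by (auto intro: LIMSEQ_unique)
    then have "V p \<in> sym_mats n" by (intro sym_matsI) (auto simp: V_def)
    moreover have "0 \<le> qform n (V p) v" for v
      using tendsto_qform[of n "\<lambda>k. W (r k) p" "V p" v] V[OF p] Wp(1)
      by (intro LIMSEQ_le_const) (auto simp: psd_mats_iff)
    moreover have "V p $$ (a, b) = 0" if "a < n" "b < n" "a \<notin> S p" for a b
      using V[OF p that(1,2)] Wp(3)[OF that(1,2)] that(3) by (auto intro: LIMSEQ_unique)
    ultimately show ?thesis by (simp add: supp_psd_def psd_mats_iff)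
  qed
  moreover have "Z $$ (a, b) = (\<Sum>p\<in>P. V p $$ (a, b))" if "a < n" "b < n" for a b
  proof (rule LIMSEQ_unique)
    show "(\<lambda>k. \<sigma> (r k) $$ (a, b)) \<longlonglongrightarrow> Z $$ (a, b)"
      using LIMSEQ_subseq_LIMSEQ[OF l[OF that] r] by (simp add: comp_def)
    show "(\<lambda>k. \<sigma> (r k) $$ (a, b)) \<longlonglongrightarrow> (\<Sum>p\<in>P. V p $$ (a, b))"
      unfolding W(2)[OF that] using V that by (intro tendsto_sum) auto
  qed
  ultimately show "Z \<in> sparse_cone n P S" using Z by (auto simp: sparse_cone_def)
qed


section \<open>Properness\<close>

lemma qform_uminus: "X \<in> carrier_mat n n \<Longrightarrow> qform n (- X) v = - qform n X v"
  by (simp add: qform_def sum_negf[symmetric])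

lemma pointed_local_psd:
  assumes cover: "\<And>a b. a < n \<Longrightarrow> b < n \<Longrightarrow> \<exists>p\<in>P. a \<in> S p \<and> b \<in> S p"
  shows "mat_pointed n (local_psd n P S)"
  unfolding mat_pointed_def
proof (intro ballI impI)
  fix X assume X: "X \<in> local_psd n P S" "- X \<in> local_psd n P S"
  then have Xs: "X \<in> sym_mats n" by (simp add: local_psd_def)
  \<comment> \<open>The forms of X and -X are both nonnegative on vectors supported in {a, b}, so
    the form of X vanishes there for all s and t.\<close>
  have 0: "s\<^sup>2 * X $$ (b, b) + 2 * s * t * X $$ (a, b) + t\<^sup>2 * X $$ (a, a) = 0"
    if ab: "a < n" "b < n" for a b s t
  proof -
    obtain p where p: "p \<in> P" "a \<in> S p" "b \<in> S p" using cover[OF ab] by blast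
    define v where "v c = (if c = b then s else 0) + (if c = a then t else 0)" for c
    have "\<forall>c. c \<notin> S p \<longrightarrow> v c = 0" using p by (auto simp: v_def)
    then have "0 \<le> qform n X v" "0 \<le> qform n (- X) v"
      using X p(1) by (auto simp: local_psd_def)
    then have "qform n X v = 0" using qform_uminus[OF sym_matsD(1)[OF Xs]] by simp
    then show ?thesis using qform_two_point[OF Xs ab, of s t] by (simp add: v_def[abs_def])
  qed
  have diag: "X $$ (a, a) = 0" if "a < n" for a using 0[OF that that, of 0 1] by simp
  have "X $$ (a, b) = 0" if "a < n" "b < n" for a b
    using 0[OF that, of 1 1] diag that by simp
  then show "X = 0\<^sub>m n n" using sym_matsD(1)[OF Xs] by (intro eq_matI) auto
qed

lemma sum_delta_pair:
  fixes c d n :: nat and f :: "nat \<Rightarrow> nat \<Rightarrow> real"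
  assumes "c < n" "d < n"
  shows "(\<Sum>a<n. \<Sum>b<n. f a b * of_bool (a = c \<and> b = d)) = f c d"
proof -
  have "(\<Sum>a<n. \<Sum>b<n. f a b * of_bool (a = c \<and> b = d)) = (\<Sum>a<n. if a = c then f c d else 0)"
  proof (rule sum.cong[OF refl])
    fix a
    have "(\<Sum>b<n. f a b * of_bool (a = c \<and> b = d)) = (\<Sum>b<n. if b = d then f c d * of_bool (a = c) else 0)"
      by (rule sum.cong) auto
    then show "(\<Sum>b<n. f a b * of_bool (a = c \<and> b = d)) = (if a = c then f c d else 0)"
      using assms by (cases "a = c") simp_all
  qed
  then show ?thesis using assms by simp
qed

text \<open>With \<open>Y = Z - I\<close>, such a \<open>Z\<close> is the sum over all index pairs \<open>(c, d)\<close> of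
  \<open>Y\<^sub>c\<^sub>d (E\<^sub>c\<^sub>d + E\<^sub>d\<^sub>c) / 2 + (E\<^sub>c\<^sub>c + E\<^sub>d\<^sub>d) / (2 n)\<close>, where \<open>E\<^sub>c\<^sub>d\<close> is a matrix unit. Each of
  these is positive semidefinite with support in \<open>{c, d}\<close>.\<close>

lemma near_identity_in_sparse_cone:
  assumes P: "finite P" and cover: "\<And>a b. a < n \<Longrightarrow> b < n \<Longrightarrow> \<exists>p\<in>P. a \<in> S p \<and> b \<in> S p"
    and Z: "Z \<in> sym_mats n"
    and near: "\<And>a b. a < n \<Longrightarrow> b < n \<Longrightarrow> \<bar>Z $$ (a, b) - 1\<^sub>m n $$ (a, b)\<bar> \<le> 1 / real n"
  shows "Z \<in> sparse_cone n P S"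
proof -
  define y where "y c d = Z $$ (c, d) - 1\<^sub>m n $$ (c, d)" for c d
  have ysym: "y d c = y c d" if "c < n" "d < n" for c d
    using that sym_matsD(3)[OF Z that] by (auto simp: y_def)
  \<comment> \<open>The sum runs over ordered pairs: (c, d) and (d, c) each carry half of the
    off-diagonal part, and every diagonal place collects 1/(2n) exactly 2n times.\<close>
  define M where "M = (\<lambda>(c, d). mat n n (\<lambda>(a, b).
     y c d / 2 * (of_bool (a = c \<and> b = d) + of_bool (a = d \<and> b = c))
       + 1 / (2 * real n) * (of_bool (a = c \<and> b = c) + of_bool (a = d \<and> b = d))))"
  have Me: "M (c, d) $$ (a, b) = y c d / 2 * (of_bool (a = c \<and> b = d) + of_bool (a = d \<and> b = c))
       + 1 / (2 * real n) * (of_bool (a = c \<and> b = c) + of_bool (a = d \<and> b = d))"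
    if "a < n" "b < n" for a b c d using that by (simp add: M_def)
  have MK: "M (c, d) \<in> sparse_cone n P S" if cd: "c < n" "d < n" for c d
  proof -
    obtain p where p: "p \<in> P" "c \<in> S p" "d \<in> S p" using cover[OF cd] by blast
    have "M (c, d) \<in> sym_mats n"
    proof (rule sym_matsI)
      show "M (c, d) \<in> carrier_mat n n" by (simp add: M_def)
      show "M (c, d) $$ (b, a) = M (c, d) $$ (a, b)" if "a < n" "b < n" for a b
        unfolding Me[OF that] Me[OF that(2,1)] by (simp only: conj_commute add.commute)
    qed
    moreover have "0 \<le> qform n (M (c, d)) v" for v
    proof -
      have "qform n (M (c, d)) v
          = (\<Sum>a<n. \<Sum>b<n. (y c d / 2 * (v a * v b)) * of_bool (a = c \<and> b = d))
          + (\<Sum>a<n. \<Sum>b<n. (y c d / 2 * (v a * v b)) * of_bool (a = d \<and> b = c))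
          + (\<Sum>a<n. \<Sum>b<n. (1 / (2 * real n) * (v a * v b)) * of_bool (a = c \<and> b = c))
          + (\<Sum>a<n. \<Sum>b<n. (1 / (2 * real n) * (v a * v b)) * of_bool (a = d \<and> b = d))"
        unfolding qform_def sum.distrib[symmetric]
        by (intro sum.cong refl) (simp add: Me algebra_simps)
      also have "\<dots> = y c d * (v c * v d) + (1 / real n) * (((v c)\<^sup>2 + (v d)\<^sup>2) / 2)"
        unfolding sum_delta_pair[OF cd] sum_delta_pair[OF cd(2,1)]
          sum_delta_pair[OF cd(1) cd(1)] sum_delta_pair[OF cd(2) cd(2)]
        by (simp add: power2_eq_square add_divide_distrib distrib_left mult.commute mult.left_commute)
      finally have eq: "qform n (M (c, d)) v = \<dots>" .
      \<comment> \<open>The arithmetic-geometric mean inequality, with |y c d| at most 1/n, lets the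
        diagonal part absorb the mixed term.\<close>
      have "\<bar>v c * v d\<bar> \<le> ((v c)\<^sup>2 + (v d)\<^sup>2) / 2"
        using sum_squares_bound[of "v c" "v d"] sum_squares_bound[of "v c" "- v d"]
        by (auto simp: abs_le_iff)
      then have "\<bar>y c d\<bar> * \<bar>v c * v d\<bar> \<le> (1 / real n) * (((v c)\<^sup>2 + (v d)\<^sup>2) / 2)"
        using near[OF cd] unfolding y_def by (intro mult_mono) auto
      then show ?thesis unfolding eq abs_mult[symmetric] by linarith
    qed
    moreover have "\<forall>a<n. \<forall>b<n. a \<notin> S p \<longrightarrow> M (c, d) $$ (a, b) = 0"
    proof (intro allI impI)
      fix a b assume ab: "a < n" "b < n" "a \<notin> S p"
      then have "a \<noteq> c" "a \<noteq> d" using p by auto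
      then show "M (c, d) $$ (a, b) = 0" unfolding Me[OF ab(1,2)] by simp
    qed
    ultimately have "M (c, d) \<in> supp_psd n (S p)" by (simp add: supp_psd_def psd_mats_iff)
    then show ?thesis using supp_psd_subset_sparse_cone[OF P p(1)] by blast
  qed
  show ?thesis
  proof (rule sparse_cone_lincomb[where I = "{..<n} \<times> {..<n}" and c = "\<lambda>_. 1" and M = M])
    show "Z \<in> carrier_mat n n" by (rule sym_matsD(1)[OF Z])
    fix a b assume ab: "a < n" "b < n"
    \<comment> \<open>For the index c = a, n copies of 1/(2n) add up to half of the identity; the
      other half is the same sum with c and d exchanged.\<close>
    have row: "(\<Sum>c<n. \<Sum>d<n. 1 / (2 * real n) * of_bool (a = c \<and> b = c)) = of_bool (a = b) / 2"
    proof -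
      have "(\<Sum>c<n. \<Sum>d<n. 1 / (2 * real n) * of_bool (a = c \<and> b = c))
          = (\<Sum>c<n. if c = a then of_bool (a = b) / 2 else 0)"
        using ab by (intro sum.cong) auto
      then show ?thesis using ab by simp
    qed
    have swap: "(c = a \<and> d = b) = (a = c \<and> b = d)" "(c = b \<and> d = a) = (a = d \<and> b = c)" for c d
      by auto
    have "(\<Sum>i\<in>{..<n} \<times> {..<n}. 1 * M i $$ (a, b)) = (\<Sum>c<n. \<Sum>d<n. M (c, d) $$ (a, b))"
      by (simp add: sum.cartesian_product case_prod_unfold)
    also have "\<dots> = (\<Sum>c<n. \<Sum>d<n. (y c d / 2) * of_bool (c = a \<and> d = b))
        + (\<Sum>c<n. \<Sum>d<n. (y c d / 2) * of_bool (c = b \<and> d = a))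
        + (\<Sum>c<n. \<Sum>d<n. 1 / (2 * real n) * of_bool (a = c \<and> b = c))
        + (\<Sum>c<n. \<Sum>d<n. 1 / (2 * real n) * of_bool (a = d \<and> b = d))"
      unfolding sum.distrib[symmetric]
      by (intro sum.cong refl) (simp only: Me[OF ab] swap distrib_left add.assoc)
    also have "(\<Sum>c<n. \<Sum>d<n. 1 / (2 * real n) * of_bool (a = d \<and> b = d)) = of_bool (a = b) / 2"
      using row by (subst sum.swap) simp
    also have "(\<Sum>c<n. \<Sum>d<n. (y c d / 2) * of_bool (c = a \<and> d = b))
        + (\<Sum>c<n. \<Sum>d<n. (y c d / 2) * of_bool (c = b \<and> d = a))
        + (\<Sum>c<n. \<Sum>d<n. 1 / (2 * real n) * of_bool (a = c \<and> b = c)) + of_bool (a = b) / 2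
        = y a b + of_bool (a = b)"
      unfolding row sum_delta_pair[OF ab] sum_delta_pair[OF ab(2,1)] ysym[OF ab] by simp
    finally show "Z $$ (a, b) = (\<Sum>i\<in>{..<n} \<times> {..<n}. 1 * M i $$ (a, b))"
      using ab by (simp add: y_def)
  qed (auto intro: MK)
qed

lemma interior_sparse_cone_nonempty:
  assumes "finite P" "\<And>a b. a < n \<Longrightarrow> b < n \<Longrightarrow> \<exists>p\<in>P. a \<in> S p \<and> b \<in> S p" "n > 0"
  shows "sym_topology n interior_of sparse_cone n P S \<noteq> {}"
proof -
  have I: "1\<^sub>m n \<in> sym_mats n" by (simp add: sym_mats_def)
  \<comment> \<open>The Frobenius distance dominates every entry difference, so the ball of radius
    1/n around the identity satisfies the entrywise bound.\<close>
  have "Metric_space.mball (sym_mats n) (frob_dist n) (1\<^sub>m n) (1 / real n) \<subseteq> sparse_cone n P S"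
  proof
    fix Z assume "Z \<in> Metric_space.mball (sym_mats n) (frob_dist n) (1\<^sub>m n) (1 / real n)"
    then have Z: "Z \<in> sym_mats n" "frob_dist n (1\<^sub>m n) Z < 1 / real n"
      by (auto simp: Metric_space.in_mball[OF Metric_space_sym_mats])
    have "\<bar>Z $$ (a, b) - 1\<^sub>m n $$ (a, b)\<bar> \<le> 1 / real n" if "a < n" "b < n" for a b
      using entry_dist_le_frob_dist[OF that, of "1\<^sub>m n" Z] Z(2) by linarith
    then show "Z \<in> sparse_cone n P S"
      using assms Z(1) by (intro near_identity_in_sparse_cone) auto
  qed
  then have "1\<^sub>m n \<in> sym_topology n interior_of sparse_cone n P S"
    unfolding sym_topology_def Metric_space.in_interior_of_mball[OF Metric_space_sym_mats]
    using I assms(3) by (intro conjI exI[of _ "1 / real n"]) auto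
  then show ?thesis by blast
qed

lemma proper_cone_sparse_cone:
  assumes "finite P" "\<And>a b. a < n \<Longrightarrow> b < n \<Longrightarrow> \<exists>p\<in>P. a \<in> S p \<and> b \<in> S p" "n > 0"
  shows "proper_cone n (sparse_cone n P S)"
  unfolding proper_cone_def
proof (intro conjI)
  show sub: "sparse_cone n P S \<subseteq> sym_mats n" by (auto simp: sparse_cone_def)
  then have c: "X \<in> carrier_mat n n" if "X \<in> sparse_cone n P S" for X
    using that sym_matsD(1) by blast
  show "mat_cone (sparse_cone n P S)"
    unfolding mat_cone_def
  proof (intro ballI allI impI)
    fix X and t :: real assume X: "X \<in> sparse_cone n P S" and t: "0 \<le> t"
    note Xc = c[OF X]
    show "t \<cdot>\<^sub>m X \<in> sparse_cone n P S"
    proof (rule sparse_cone_lincomb[where I = "{()}" and c = "\<lambda>_. t" and M = "\<lambda>_. X"])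
      show "t \<cdot>\<^sub>m X \<in> carrier_mat n n" using Xc by simp
      show "(t \<cdot>\<^sub>m X) $$ (a, b) = (\<Sum>i\<in>{()}. t * X $$ (a, b))" if "a < n" "b < n" for a b
        using Xc that by simp
    qed (rule X t)+
  qed
  show "mat_convex (sparse_cone n P S)"
    unfolding mat_convex_def
  proof (intro ballI allI impI)
    fix X Y and u v :: real
    assume XY: "X \<in> sparse_cone n P S" "Y \<in> sparse_cone n P S" and uv: "0 \<le> u" "0 \<le> v"
    note XYc = c[OF XY(1)] c[OF XY(2)]
    show "u \<cdot>\<^sub>m X + v \<cdot>\<^sub>m Y \<in> sparse_cone n P S"
    \<comment> \<open>The two Booleans serve as the index set of a two-term combination.\<close>
    proof (rule sparse_cone_lincomb[where I = UNIV and c = "\<lambda>i. if i then u else v"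
            and M = "\<lambda>i. if i then X else Y"])
      show "u \<cdot>\<^sub>m X + v \<cdot>\<^sub>m Y \<in> carrier_mat n n" using XYc by simp
      show "(u \<cdot>\<^sub>m X + v \<cdot>\<^sub>m Y) $$ (a, b)
          = (\<Sum>i\<in>UNIV. (if i then u else v) * (if i then X else Y) $$ (a, b))"
        if "a < n" "b < n" for a b
        using XYc that by (simp add: UNIV_bool)
    qed (use XY uv in simp_all)
  qed
  show "closedin (sym_topology n) (sparse_cone n P S)" by (rule closedin_sparse_cone[OF assms(1)])
  show "sym_topology n interior_of sparse_cone n P S \<noteq> {}"
    by (rule interior_sparse_cone_nonempty[OF assms])
  \<comment> \<open>Pointedness is inherited by subsets, here from the larger dual.\<close>
  show "mat_pointed n (sparse_cone n P S)"
    using pointed_local_psd[OF assms(2)] sparse_cone_subset_local_psd[of n P S P S]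
    unfolding mat_pointed_def by blast
qed

lemma proper_cone_local_psd:
  assumes "finite P" "\<And>a b. a < n \<Longrightarrow> b < n \<Longrightarrow> \<exists>p\<in>P. a \<in> S p \<and> b \<in> S p" "n > 0"
  shows "proper_cone n (local_psd n P S)"
  unfolding proper_cone_def
proof (intro conjI)
  show sub: "local_psd n P S \<subseteq> sym_mats n" by (auto simp: local_psd_def)
  have sym: "u \<cdot>\<^sub>m X + v \<cdot>\<^sub>m Y \<in> sym_mats n" if "X \<in> sym_mats n" "Y \<in> sym_mats n" for X Y and u v :: real
    using sym_matsD(1,3)[OF that(1)] sym_matsD(1,3)[OF that(2)] by (intro sym_matsI) auto
  have q: "qform n (u \<cdot>\<^sub>m X + v \<cdot>\<^sub>m Y) w = u * qform n X w + v * qform n Y w"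
    if "X \<in> sym_mats n" "Y \<in> sym_mats n" for X Y w and u v :: real
    using sym_matsD(1)[OF that(1)] sym_matsD(1)[OF that(2)]
    by (simp add: qform_def sum_distrib_left sum.distrib[symmetric] algebra_simps)
  have comb: "u \<cdot>\<^sub>m X + v \<cdot>\<^sub>m Y \<in> local_psd n P S"
    if "X \<in> local_psd n P S" "Y \<in> local_psd n P S" "0 \<le> u" "0 \<le> v" for X Y and u v :: real
    using that by (simp add: local_psd_def sym q)
  show "mat_convex (local_psd n P S)" using comb by (simp add: mat_convex_def)
  show "mat_cone (local_psd n P S)"
    unfolding mat_cone_def
  proof (intro ballI allI impI)
    fix X and t :: real assume X: "X \<in> local_psd n P S" "0 \<le> t"
    then have "X \<in> carrier_mat n n" using sub sym_matsD(1) by blast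
    then have "t \<cdot>\<^sub>m X + 0 \<cdot>\<^sub>m X = t \<cdot>\<^sub>m X" by (intro eq_matI) auto
    then show "t \<cdot>\<^sub>m X \<in> local_psd n P S" using comb[OF X(1) X(1) X(2), of 0] by simp
  qed
  show "closedin (sym_topology n) (local_psd n P S)" by (rule closedin_local_psd)
  \<comment> \<open>The dual contains the cone, hence also its interior points.\<close>
  show "sym_topology n interior_of local_psd n P S \<noteq> {}"
    using interior_sparse_cone_nonempty[OF assms]
      interior_of_mono[OF sparse_cone_subset_local_psd[of n P S P S]] by blast
  show "mat_pointed n (local_psd n P S)" by (rule pointed_local_psd[OF assms(2)])
qed

section \<open>Block selection matrices\<close>

text \<open>Row r of \<open>E\<close> is the unit row vector at \<open>s r\<close>, and
  \<open>s\<close> enumerates \<open>S\<close>. Thus \<open>E * W * transpose_mat E\<close> is the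
  principal submatrix of \<open>W\<close> on \<open>S\<close>, and
  \<open>transpose_mat E * Y * E\<close> pads \<open>Y\<close> with zeros.\<close>

locale selection_matrix =
  fixes E :: "real mat" and m n :: nat and s :: "nat \<Rightarrow> nat" and S :: "nat set"
  assumes E_carrier: "E \<in> carrier_mat m n"
    and E_entry: "\<And>r c. r < m \<Longrightarrow> c < n \<Longrightarrow> E $$ (r, c) = of_bool (c = s r)"
    and s_bij: "bij_betw s {..<m} S"
    and S_sub: "S \<subseteq> {..<n}"
begin

lemma s_less: "r < m \<Longrightarrow> s r < n"
  using s_bij S_sub by (auto simp: bij_betw_def)

lemma s_mem: "r < m \<Longrightarrow> s r \<in> S"
  using s_bij by (auto simp: bij_betw_def)

lemma reindex: "(\<Sum>r<m. g (s r)) = (\<Sum>c\<in>S. g c)" for g :: "nat \<Rightarrow> real"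
  using sum.reindex_bij_betw[OF s_bij] .

lemma compress_entry:
  assumes W: "W \<in> carrier_mat n n" and r: "r < m" "r' < m"
  shows "(E * W * transpose_mat E) $$ (r, r') = W $$ (s r, s r')"
proof -
  have "(E * W * transpose_mat E) $$ (r, r')
      = (\<Sum>a<n. E $$ (r, a) * (\<Sum>b<n. W $$ (a, b) * E $$ (r', b)))"
    using E_carrier W r by (simp add: scalar_prod_def atLeast0LessThan)
  also have "\<dots> = (\<Sum>a<n. \<Sum>b<n. W $$ (a, b) * of_bool (a = s r \<and> b = s r'))"
    unfolding sum_distrib_left using r by (intro sum.cong refl) (simp add: E_entry)
  also have "\<dots> = W $$ (s r, s r')"
    by (rule sum_delta_pair) (use r s_less in simp_all)
  finally show ?thesis .
qed

lemma expand_entry: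
  assumes Y: "Y \<in> carrier_mat m m" and ab: "a < n" "b < n"
  shows "(transpose_mat E * Y * E) $$ (a, b)
    = (\<Sum>r<m. \<Sum>r'<m. of_bool (s r = a) * of_bool (s r' = b) * Y $$ (r, r'))"
proof -
  have "(transpose_mat E * Y * E) $$ (a, b)
      = (\<Sum>r<m. E $$ (r, a) * (\<Sum>r'<m. Y $$ (r, r') * E $$ (r', b)))"
    using E_carrier Y ab by (simp add: scalar_prod_def atLeast0LessThan)
  also have "\<dots> = (\<Sum>r<m. \<Sum>r'<m. of_bool (s r = a) * of_bool (s r' = b) * Y $$ (r, r'))"
    unfolding sum_distrib_left using ab by (intro sum.cong refl) (auto simp: E_entry)
  finally show ?thesis .
qed

lemma expand_supp_psd:
  assumes "Y \<in> psd_mats m"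
  shows "transpose_mat E * Y * E \<in> supp_psd n S"
proof -
  have Y: "Y \<in> carrier_mat m m" using assms sym_matsD(1) by (auto simp: psd_mats_def)
  have "(transpose_mat E * Y * E) $$ (a, b) = 0" if "a < n" "b < n" "a \<notin> S" for a b
    unfolding expand_entry[OF Y that(1,2)] using that(3) s_mem by (intro sum.neutral) auto
  then show ?thesis using psd_mats_congruence[OF assms E_carrier] by (simp add: supp_psd_def)
qed

lemma compress_psd:
  assumes "W \<in> psd_mats n"
  shows "E * W * transpose_mat E \<in> psd_mats m"
  using psd_mats_congruence[OF assms, of "transpose_mat E" m] E_carrier by simp

text \<open>Extracting the submatrix on \<open>S\<close> and padding it back loses nothing when
  \<open>W\<close> vanishes off \<open>S\<close>. Hence every matrix in \<open>supp_psd n S\<close>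
  arises by padding.\<close>

lemma expand_compress:
  assumes W: "W \<in> supp_psd n S"
  shows "transpose_mat E * (E * W * transpose_mat E) * E = W"
proof (rule eq_matI)
  note Wc = sym_matsD(1)[OF supp_psdD(2)[OF W]]
  have fin: "finite S" using S_sub finite_subset by blast
  show "dim_row (transpose_mat E * (E * W * transpose_mat E) * E) = dim_row W"
    "dim_col (transpose_mat E * (E * W * transpose_mat E) * E) = dim_col W"
    using E_carrier Wc by auto
  fix a b assume "a < dim_row W" "b < dim_col W"
  then have ab: "a < n" "b < n" using Wc by auto
  have "(transpose_mat E * (E * W * transpose_mat E) * E) $$ (a, b)
      = (\<Sum>r<m. \<Sum>r'<m. of_bool (s r = a) * of_bool (s r' = b) * (E * W * transpose_mat E) $$ (r, r'))"
    using E_carrier Wc by (intro expand_entry ab) auto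
  also have "\<dots> = (\<Sum>r<m. \<Sum>r'<m. of_bool (s r = a) * of_bool (s r' = b) * W $$ (s r, s r'))"
    by (intro sum.cong refl) (simp add: compress_entry[OF Wc] del: index_mult_mat)
  also have "\<dots> = (\<Sum>c\<in>S. \<Sum>d\<in>S. of_bool (c = a) * of_bool (d = b) * W $$ (c, d))"
    using reindex[of "\<lambda>c. \<Sum>r'<m. of_bool (c = a) * of_bool (s r' = b) * W $$ (c, s r')"]
      reindex[of "\<lambda>d. of_bool (_ = a) * of_bool (d = b) * W $$ (_, d)"] by simp
  also have "\<dots> = (\<Sum>c\<in>S. if c = a then (\<Sum>d\<in>S. if d = b then W $$ (a, b) else 0) else 0)"
    by (intro sum.cong) (auto intro!: sum.cong)
  also have "\<dots> = (if a \<in> S \<and> b \<in> S then W $$ (a, b) else 0)" using fin by simp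
  also have "\<dots> = W $$ (a, b)" using supp_psdD(3)[OF W ab] by auto
  finally show "(transpose_mat E * (E * W * transpose_mat E) * E) $$ (a, b) = W $$ (a, b)" .
qed

lemma qform_supported:
  assumes X: "X \<in> carrier_mat n n" and v: "\<And>a. a \<notin> S \<Longrightarrow> v a = 0"
  shows "qform n X v = qform m (E * X * transpose_mat E) (\<lambda>r. v (s r))"
proof -
  have "qform n X v = (\<Sum>a<n. \<Sum>b\<in>S. v a * X $$ (a, b) * v b)"
    unfolding qform_def using v S_sub by (intro sum.cong refl sum.mono_neutral_right) auto
  also have "\<dots> = (\<Sum>a\<in>S. \<Sum>b\<in>S. v a * X $$ (a, b) * v b)"
    using v S_sub by (intro sum.mono_neutral_right) auto
  also have "\<dots> = (\<Sum>r<m. \<Sum>r'<m. v (s r) * X $$ (s r, s r') * v (s r'))"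
    by (simp add: reindex[symmetric])
  also have "\<dots> = qform m (E * X * transpose_mat E) (\<lambda>r. v (s r))"
    unfolding qform_def by (intro sum.cong refl) (simp add: compress_entry[OF X] del: index_mult_mat)
  finally show ?thesis .
qed

text \<open>Through \<open>s\<close>, vectors of length \<open>m\<close> correspond to vectors
  supported in \<open>S\<close>, with equal values of the two forms.\<close>

lemma compress_psd_iff:
  assumes X: "X \<in> sym_mats n"
  shows "E * X * transpose_mat E \<in> psd_mats m \<longleftrightarrow>
    (\<forall>v. (\<forall>a. a \<notin> S \<longrightarrow> v a = 0) \<longrightarrow> 0 \<le> qform n X v)"
proof
  assume "E * X * transpose_mat E \<in> psd_mats m"
  then show "\<forall>v. (\<forall>a. a \<notin> S \<longrightarrow> v a = 0) \<longrightarrow> 0 \<le> qform n X v"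
    using qform_supported[OF sym_matsD(1)[OF X]] by (simp add: psd_mats_iff)
next
  assume nn: "\<forall>v. (\<forall>a. a \<notin> S \<longrightarrow> v a = 0) \<longrightarrow> 0 \<le> qform n X v"
  have "0 \<le> qform m (E * X * transpose_mat E) w" for w
  proof -
    \<comment> \<open>Transport \<open>w\<close> along the inverse of \<open>s\<close> and extend it
      by zero off \<open>S\<close>.\<close>
    define v where "v a = (if a \<in> S then w (inv_into {..<m} s a) else 0)" for a
    have "qform m (E * X * transpose_mat E) w = qform m (E * X * transpose_mat E) (\<lambda>r. v (s r))"
      using s_mem s_bij by (intro qform_cong) (auto simp: v_def bij_betw_def inv_into_f_f)
    also have "\<dots> = qform n X v"
      using qform_supported[OF sym_matsD(1)[OF X], of v] by (simp add: v_def)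
    finally show ?thesis using nn by (simp add: v_def)
  qed
  moreover have "E * X * transpose_mat E \<in> sym_mats m"
  proof (rule sym_matsI)
    note Xc = sym_matsD(1)[OF X]
    show "E * X * transpose_mat E \<in> carrier_mat m m" using E_carrier Xc by simp
    show "(E * X * transpose_mat E) $$ (r', r) = (E * X * transpose_mat E) $$ (r, r')"
      if "r < m" "r' < m" for r r'
      unfolding compress_entry[OF Xc that] compress_entry[OF Xc that(2,1)]
      by (rule sym_matsD(3)[OF X s_less[OF that(1)] s_less[OF that(2)]])
  qed
  ultimately show "E * X * transpose_mat E \<in> psd_mats m" by (simp add: psd_mats_iff)
qed

end

section \<open>Consecutive index blocks of a partition\<close>

definition block_start :: "nat list \<Rightarrow> nat \<Rightarrow> nat" where
  "block_start ks i = sum_list (take i ks)"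

definition block :: "nat list \<Rightarrow> nat \<Rightarrow> nat set" where
  "block ks i = {block_start ks i..<block_start ks i + ks ! i}"

lemma block_start_Suc: "i < length ks \<Longrightarrow> block_start ks (Suc i) = block_start ks i + ks ! i"
  by (simp add: block_start_def take_Suc_conv_app_nth)

lemma block_start_mono: "i \<le> j \<Longrightarrow> block_start ks i \<le> block_start ks j"
proof (induction rule: dec_induct)
  case (step m)
  \<comment> \<open>From \<open>length ks\<close> on, \<open>take\<close> returns the whole list and
    the start stays at the total.\<close>
  then show ?case
    by (cases "m < length ks") (simp_all add: block_start_Suc, simp add: block_start_def)
qed simp

lemma block_end_le: "i < j \<Longrightarrow> i < length ks \<Longrightarrow> block_start ks i + ks ! i \<le> block_start ks j"
  using block_start_mono[of "Suc i" j ks] by (simp add: block_start_Suc)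

lemma block_end_le_sum: "i < length ks \<Longrightarrow> block_start ks i + ks ! i \<le> sum_list ks"
  using block_end_le[of i "length ks" ks] by (simp add: block_start_def)

lemma block_cover:
  assumes "a < sum_list ks"
  shows "\<exists>i<length ks. a \<in> block ks i"
proof -
  have "a < block_start ks j \<Longrightarrow> j \<le> length ks \<Longrightarrow> \<exists>i<j. a \<in> block ks i" for j
  proof (induction j)
    case 0
    then show ?case by (simp add: block_start_def)
  next
    case (Suc j)
    then show ?case
      by (cases "a < block_start ks j") (auto simp: block_def block_start_Suc less_Suc_eq)
  qed
  from this[of "length ks"] show ?thesis using assms by (simp add: block_start_def)
qed

text \<open>The column of the single one in row r of the stacked matrix for blocks i and j.\<close>

definition block_index :: "nat list \<Rightarrow> nat \<Rightarrow> nat \<Rightarrow> nat \<Rightarrow> nat" where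
  "block_index ks i j r =
     (if r < ks ! i then block_start ks i + r else block_start ks j + (r - ks ! i))"

lemma selection_block_row2:
  assumes ij: "i < j" "j < length ks" and n: "sum_list ks = n"
  shows "selection_matrix (block_row2 ks n i j) (ks ! i + ks ! j) n (block_index ks i j)
    (block ks i \<union> block ks j)"
proof
  have le: "block_start ks i + ks ! i \<le> n" "block_start ks j + ks ! j \<le> n"
    "block_start ks i + ks ! i \<le> block_start ks j"
    using ij block_end_le_sum[of i ks] block_end_le_sum[of j ks] block_end_le[of i j ks] n by auto
  show "block_row2 ks n i j \<in> carrier_mat (ks ! i + ks ! j) n"
    by (auto simp: block_row2_def block_row_def)
  show "block_row2 ks n i j $$ (r, c) = of_bool (c = block_index ks i j r)"
    if "r < ks ! i + ks ! j" "c < n" for r c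
    using that le
    by (auto simp: block_row2_def block_row_def append_rows_def block_index_def
        block_start_def[symmetric])
  show "block ks i \<union> block ks j \<subseteq> {..<n}" using le by (auto simp: block_def)
  show "bij_betw (block_index ks i j) {..<ks ! i + ks ! j} (block ks i \<union> block ks j)"
    using le
    \<comment> \<open>The inverse subtracts the block offset; it is well defined because block i
      ends before block j begins.\<close>
    by (intro bij_betw_byWitness[where f' = "\<lambda>c. if c \<in> block ks i then c - block_start ks i
          else ks ! i + (c - block_start ks j)"])
      (auto simp: block_def block_index_def)
qed

section \<open>The cone of block factor-width-two matrices\<close>

text \<open>Carrier membership and the entry formula are proved together, since reading an entry
  after inserting a summand requires the dimensions of the remaining sum.\<close>

lemma finsum_mat_carrier_index:
  fixes f :: "'b \<Rightarrow> 'a :: comm_ring_1 mat"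
  assumes "\<And>x. x \<in> A \<Longrightarrow> f x \<in> carrier_mat nr nc"
  shows "finsum (module_mat TYPE('a) nr nc) f A \<in> carrier_mat nr nc
    \<and> (finite A \<longrightarrow> (\<forall>a<nr. \<forall>b<nc. finsum (module_mat TYPE('a) nr nc) f A $$ (a, b) = (\<Sum>x\<in>A. f x $$ (a, b))))"
  using assms
proof (induction A rule: infinite_finite_induct)
  case (infinite A)
  then show ?case
    by (simp add: finsum_def finprod_def module_mat_def)
next
  case empty
  interpret abelian_group "module_mat TYPE('a) nr nc" by (rule abelian_group_mat)
  show ?case using finsum_empty by (simp add: module_mat_simps)
next
  case (insert x F)
  interpret abelian_group "module_mat TYPE('a) nr nc" by (rule abelian_group_mat)
  have "finsum (module_mat TYPE('a) nr nc) f (insert x F) = f x + finsum (module_mat TYPE('a) nr nc) f F"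
    using insert finsum_insert[of F x f] by (auto simp: module_mat_simps)
  then show ?case using insert by auto
qed

definition block_pairs :: "nat list \<Rightarrow> (nat \<times> nat) set" where
  "block_pairs ks = {(i, j). i < j \<and> j < length ks}"

definition pair_support :: "nat list \<Rightarrow> nat \<times> nat \<Rightarrow> nat set" where
  "pair_support ks = (\<lambda>(i, j). block ks i \<union> block ks j)"

lemma block_pairs_Sigma: "block_pairs ks = (SIGMA i:{0..<length ks - 1}. {i+1..<length ks})"
  by (auto simp: block_pairs_def)

lemma finite_block_pairs: "finite (block_pairs ks)"
  by (simp add: block_pairs_Sigma)

lemma pair_support_cover:
  assumes "length ks \<ge> 2" "a < sum_list ks" "b < sum_list ks"
  shows "\<exists>p\<in>block_pairs ks. a \<in> pair_support ks p \<and> b \<in> pair_support ks p"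
proof -
  obtain i j where ij: "i < length ks" "a \<in> block ks i" "j < length ks" "b \<in> block ks j"
    using block_cover assms by blast
  \<comment> \<open>A second block is available as partner when a and b lie in the same block; this
    is where at least two blocks are needed.\<close>
  obtain l where l: "l < length ks" "l \<noteq> i"
    using assms(1) by (metis Suc_1 Suc_le_lessD less_2_cases_iff less_le_trans zero_less_Suc zero_neq_one)
  define k where "k = (if i = j then l else j)"
  have "k \<noteq> i" "k < length ks" using l ij by (auto simp: k_def)
  then have "(min i k, max i k) \<in> block_pairs ks" using ij by (auto simp: block_pairs_def)
  moreover have "pair_support ks (min i k, max i k) = block ks i \<union> block ks k"
    by (auto simp: pair_support_def min_def max_def)
  moreover have "b \<in> block ks i \<union> block ks k" using ij by (auto simp: k_def)
  ultimately show ?thesis using ij(2) by blast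
qed

text \<open>Entrywise, the nested group sums become one sum over all pairs i < j; the outer range
  omits the last block, which has no later partner.\<close>

lemma FW2_sum_iff:
  assumes E: "\<And>i j. i < j \<Longrightarrow> j < length ks \<Longrightarrow> W i j \<in> carrier_mat n n" and Z: "Z \<in> carrier_mat n n"
  shows "Z = finsum (module_mat TYPE(real) n n)
      (\<lambda>i. finsum (module_mat TYPE(real) n n) (W i) {i+1..<length ks}) {0..<length ks - 1}
    \<longleftrightarrow> (\<forall>a<n. \<forall>b<n. Z $$ (a, b) = (\<Sum>(i, j)\<in>block_pairs ks. W i j $$ (a, b)))"
    (is "Z = ?F \<longleftrightarrow> _")
proof -
  let ?G = "\<lambda>i. finsum (module_mat TYPE(real) n n) (W i) {i+1..<length ks}"
  have G: "?G i \<in> carrier_mat n n"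
    "a < n \<Longrightarrow> b < n \<Longrightarrow> ?G i $$ (a, b) = (\<Sum>j\<in>{i+1..<length ks}. W i j $$ (a, b))" for i a b
    using finsum_mat_carrier_index[of "{i+1..<length ks}" "W i" n n] E by auto
  have F: "?F \<in> carrier_mat n n"
    "a < n \<Longrightarrow> b < n \<Longrightarrow> ?F $$ (a, b) = (\<Sum>(i, j)\<in>block_pairs ks. W i j $$ (a, b))" for a b
    using finsum_mat_carrier_index[of "{0..<length ks - 1}" ?G n n] G
    by (auto simp: block_pairs_Sigma sum.Sigma)
  show ?thesis
  proof
    assume "\<forall>a<n. \<forall>b<n. Z $$ (a, b) = (\<Sum>(i, j)\<in>block_pairs ks. W i j $$ (a, b))"
    then show "Z = ?F" using Z F by (intro eq_matI) auto
  qed (use F in simp)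
qed

text \<open>The congruences by E_ij produce exactly the positive semidefinite matrices supported on
  blocks i and j: padding gives one inclusion, compression the other.\<close>

lemma FW2_eq_sparse_cone:
  assumes n: "sum_list ks = n"
  shows "FW2 ks n = sparse_cone n (block_pairs ks) (pair_support ks)"
proof (intro equalityI subsetI)
  fix Z assume "Z \<in> FW2 ks n"
  then obtain X where Z: "Z \<in> sym_mats n"
    and X: "\<And>i j. i < j \<Longrightarrow> j < length ks \<Longrightarrow> X i j \<in> psd_mats (ks ! i + ks ! j)"
    and Zeq: "Z = finsum (module_mat TYPE(real) n n)
           (\<lambda>i. finsum (module_mat TYPE(real) n n)
             (\<lambda>j. transpose_mat (block_row2 ks n i j) * X i j * block_row2 ks n i j)
             {i+1..<length ks})
           {0..<length ks - 1}"
    unfolding FW2_def by blast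
  define W where "W i j = transpose_mat (block_row2 ks n i j) * X i j * block_row2 ks n i j" for i j
  have W: "W i j \<in> supp_psd n (pair_support ks (i, j))" if "i < j" "j < length ks" for i j
    using selection_matrix.expand_supp_psd[OF selection_block_row2[OF that n] X[OF that]]
    by (simp add: W_def pair_support_def)
  then have "\<forall>a<n. \<forall>b<n. Z $$ (a, b) = (\<Sum>(i, j)\<in>block_pairs ks. W i j $$ (a, b))"
    using FW2_sum_iff[of ks W n Z] Zeq sym_matsD(1)[OF Z] sym_matsD(1) supp_psdD(2)
    unfolding W_def by blast
  then show "Z \<in> sparse_cone n (block_pairs ks) (pair_support ks)"
    using Z W unfolding sparse_cone_def
    by (intro CollectI conjI exI[of _ "\<lambda>(i, j). W i j"])
      (auto simp: block_pairs_def case_prod_unfold)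
next
  fix Z assume "Z \<in> sparse_cone n (block_pairs ks) (pair_support ks)"
  then obtain W where Z: "Z \<in> sym_mats n"
    and W: "\<And>p. p \<in> block_pairs ks \<Longrightarrow> W p \<in> supp_psd n (pair_support ks p)"
    and Zeq: "\<forall>a<n. \<forall>b<n. Z $$ (a, b) = (\<Sum>p\<in>block_pairs ks. W p $$ (a, b))"
    unfolding sparse_cone_def by blast
  \<comment> \<open>The principal submatrix of the summand on blocks i and j recovers the required
    small matrix.\<close>
  define X where "X i j = block_row2 ks n i j * W (i, j) * transpose_mat (block_row2 ks n i j)" for i j
  have X: "X i j \<in> psd_mats (ks ! i + ks ! j)"
    and WX: "transpose_mat (block_row2 ks n i j) * X i j * block_row2 ks n i j = W (i, j)"
    if "i < j" "j < length ks" for i j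
  proof -
    interpret selection_matrix "block_row2 ks n i j" "ks ! i + ks ! j" n "block_index ks i j"
      "block ks i \<union> block ks j"
      by (rule selection_block_row2[OF that n])
    have "W (i, j) \<in> supp_psd n (block ks i \<union> block ks j)"
      using W[of "(i, j)"] that by (simp add: block_pairs_def pair_support_def)
    then show "X i j \<in> psd_mats (ks ! i + ks ! j)"
      "transpose_mat (block_row2 ks n i j) * X i j * block_row2 ks n i j = W (i, j)"
      unfolding X_def by (auto intro: compress_psd expand_compress supp_psdD(1))
  qed
  have "(\<Sum>(i, j)\<in>block_pairs ks. (transpose_mat (block_row2 ks n i j) * X i j * block_row2 ks n i j) $$ (a, b))
      = (\<Sum>p\<in>block_pairs ks. W p $$ (a, b))" for a b
    by (intro sum.cong refl) (auto simp: block_pairs_def WX simp del: index_mult_mat)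
  moreover have "transpose_mat (block_row2 ks n i j) * X i j * block_row2 ks n i j \<in> carrier_mat n n"
    if "i < j" "j < length ks" for i j
    using sym_matsD(1)[OF supp_psdD(2)[OF W[of "(i, j)"]]] that
    unfolding WX[OF that] by (simp add: block_pairs_def)
  ultimately have "Z = finsum (module_mat TYPE(real) n n)
           (\<lambda>i. finsum (module_mat TYPE(real) n n)
             (\<lambda>j. transpose_mat (block_row2 ks n i j) * X i j * block_row2 ks n i j)
             {i+1..<length ks})
           {0..<length ks - 1}"
    using Zeq sym_matsD(1)[OF Z] by (subst FW2_sum_iff) simp_all
  then show "Z \<in> FW2 ks n"
    using Z X unfolding FW2_def by blast
qed

lemma local_psd_block_pairs:
  assumes n: "sum_list ks = n"
  shows "local_psd n (block_pairs ks) (pair_support ks) =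
    {X \<in> sym_mats n. \<forall>i j. i < j \<and> j < length ks \<longrightarrow>
      block_row2 ks n i j * X * transpose_mat (block_row2 ks n i j) \<in> psd_mats (ks ! i + ks ! j)}"
  using selection_matrix.compress_psd_iff[OF selection_block_row2[OF _ _ n]]
  by (auto simp: local_psd_def block_pairs_def pair_support_def)

theorem proposition1:
  fixes ks :: "nat list" and n :: nat
  assumes "is_partition ks n" and "length ks \<ge> 2"
  shows "dual_cone n (FW2 ks n) =
           {X \<in> sym_mats n. \<forall>i j. i < j \<and> j < length ks \<longrightarrow>
              block_row2 ks n i j * X * transpose_mat (block_row2 ks n i j)
                \<in> psd_mats (ks ! i + ks ! j)}
         \<and> proper_cone n (FW2 ks n)
         \<and> proper_cone n (dual_cone n (FW2 ks n))"
proof -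
  have n: "sum_list ks = n" and pos: "\<forall>k\<in>set ks. 0 < k" using assms(1) by (auto simp: is_partition_def)
  \<comment> \<open>A first block exists and is nonempty, so \<open>n\<close> is positive, as the
    interior argument requires.\<close>
  have "ks ! 0 \<in> set ks" using assms(2) by (intro nth_mem) auto
  then have "n > 0" using n pos member_le_sum_list[of "ks ! 0" ks] by fastforce
  note proper = finite_block_pairs pair_support_cover[OF assms(2), unfolded n] this
  have dual: "dual_cone n (FW2 ks n) = local_psd n (block_pairs ks) (pair_support ks)"
    unfolding FW2_eq_sparse_cone[OF n] by (rule dual_sparse_cone[OF finite_block_pairs])
  show ?thesis
    unfolding dual unfolding FW2_eq_sparse_cone[OF n]
  proof (intro conjI)
    show "proper_cone n (sparse_cone n (block_pairs ks) (pair_support ks))"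
      by (rule proper_cone_sparse_cone[OF proper])
    show "proper_cone n (local_psd n (block_pairs ks) (pair_support ks))"
      by (rule proper_cone_local_psd[OF proper])
  qed (rule local_psd_block_pairs[OF n])
qed

end
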